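(* Let $A$ be a point or vector configuration of rank $r$ and let $T$ index a non-empty partial triangulation of $A$. If $T$ is right-extendable, then there is a covering set of simplex indices $C\subseteq\mathrm{adm}(T)$ such that (i) the covering set is pairwise properly intersecting: for each $s\in C$ and all $s'\in C\setminus\{s\}$ the simplices $s$ and $s'$ intersect properly; (ii) the covering set covers all free interior facets: for each $f\in\mathrm{free}(T)$ there is an $s\in C$ with $f\in\mathrm{intfacets}(s)$.
   Context: $A\in\mathbb{R}^{r\times n}$ has rank $r$ and columns $a_1,\dots,a_n$ (points in homogeneous coordinates, or vectors). A circuit is an inclusion-minimal linearly dependent set $C$ of column indices; a circuit signature splits $C=C_+\cup C_-$ such that $\sum_{i\in C_+}\lambda_ia_i=\sum_{i\in C_-}\lambda_ia_i$ for some $\lambda_i>0$, and $(C_+,C_-)$ is a signed circuit (each circuit yields two opposite ones). A cocircuit is an inclusion-maximal index set $C_0^*$ with $\operatorname{rank}(A_{C_0^*})<r$; with a non-zero $c\in\mathbb{R}^r$ satisfying $c^\top a_i=0$ exactly for $i\in C_0^*$ put $C_\pm^*=\{i:\pm c^\top a_i>0\}$. A simplex is an index set $S$ of size $r$ with $\operatorname{rank}(A_S)=r$; its facets are its $(r-1)$-subsets. Two simplices $S_1,S_2$ intersect properly if there is no signed circuit with $C_+\subseteq S_1$ and $C_-\subseteq S_2$. A simplex facet $F$ is interior if there is a cocircuit $C_0^*\supseteq F$ with $C_+^*$ and $C_-^*$ both non-empty. A triangulation is a non-empty set $\mathcal{T}$ of pairwise properly intersecting (feasible) simplices that is covering: for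 each interior facet $F$ of some $S\in\mathcal{T}$ there is another $S'\in\mathcal{T}$ containing $F$. A partial triangulation is a set of pairwise properly intersecting (feasible) simplices. (The set of feasible simplices, the ones considered in the enumeration, may be all simplices or a restricted set depending on the enumeration task.) Lexicographic order on sets of integers: $\emptyset\prec S$ for $S\ne\emptyset$; for non-empty $S,R$: $S\prec R$ iff $\min S<\min R$, or the minima agree and $S\setminus\{\min S\}\prec R\setminus\{\min R\}$. The $N$ feasible simplices are numbered $1,\dots,N$ in increasing lexicographic order, and the $M$ interior simplex facets are numbered $1,\dots,M$ in increasing lexicographic order; simplices and facets are identified with their numbers, and $T\subseteq\{1,\dots,N\}$ indexes the corresponding set of simplices. For $s\in\{1,\dots,N\}$, $\mathrm{intfacets}(s)\subseteq\{1,\dots,M\}$ is the set of (numbers of) interior facets of simplex $s$. For $T$ indexing a partial triangulation, $\mathrm{adm}(T)$ is the set of all $s\in\{1,\dots,N\}$ such that for all $s'\in T$: $s>s'$ and simplex $s$ intersects simplex $s'$ properly; $\mathrm{free}(T)$ is the set of $f\in\{1,\dots,M\}$ with $f\in\mathrm{intfacets}(s)$ for exactly one $s\in T$. $T$ is right-extendable if there is a $T'\supseteq T$ indexing a triangulation such that every element of $T'\setminus T$ is larger than every element of $T$. *)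

theory Defs
  imports "Jordan_Normal_Form.DL_Rank_Submatrix"
begin

(* A configuration is a real matrix A; its columns a_1, ..., a_n are indexed here by 0, ..., n - 1.
   Everything is phrased through index sets, so that repeated columns are kept apart. *)

definition rank_cols :: "real mat \<Rightarrow> nat set \<Rightarrow> nat" where
  "rank_cols A S = vec_space.rank (dim_row A) (submatrix A UNIV S)"

definition comb :: "real mat \<Rightarrow> (nat \<Rightarrow> real) \<Rightarrow> nat set \<Rightarrow> real vec" where
  "comb A l S = finsum_vec TYPE(real) (dim_row A) (\<lambda>i. l i \<cdot>\<^sub>v col A i) S"

definition dependent_cols :: "real mat \<Rightarrow> nat set \<Rightarrow> bool" where
  "dependent_cols A C \<longleftrightarrow> C \<subseteq> {..<dim_col A} \<and>
     (\<exists>l. (\<exists>i\<in>C. l i \<noteq> 0) \<and> comb A l C = 0\<^sub>v (dim_row A))"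

definition circuit :: "real mat \<Rightarrow> nat set \<Rightarrow> bool" where
  "circuit A C \<longleftrightarrow> dependent_cols A C \<and> (\<forall>D. D \<subset> C \<longrightarrow> \<not> dependent_cols A D)"

definition signed_circuit :: "real mat \<Rightarrow> nat set \<Rightarrow> nat set \<Rightarrow> bool" where
  "signed_circuit A Cp Cn \<longleftrightarrow> circuit A (Cp \<union> Cn) \<and> Cp \<inter> Cn = {} \<and>
     (\<exists>l. (\<forall>i\<in>Cp \<union> Cn. 0 < l i) \<and> comb A l Cp = comb A l Cn)"

definition cocircuit :: "real mat \<Rightarrow> nat set \<Rightarrow> bool" where
  "cocircuit A C0 \<longleftrightarrow> C0 \<subseteq> {..<dim_col A} \<and> rank_cols A C0 < dim_row A \<and>
     (\<forall>D. C0 \<subset> D \<and> D \<subseteq> {..<dim_col A} \<longrightarrow> \<not> rank_cols A D < dim_row A)"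

definition cocircuit_normal :: "real mat \<Rightarrow> nat set \<Rightarrow> real vec \<Rightarrow> bool" where
  "cocircuit_normal A C0 c \<longleftrightarrow> c \<in> carrier_vec (dim_row A) \<and> c \<noteq> 0\<^sub>v (dim_row A) \<and>
     (\<forall>i<dim_col A. c \<bullet> col A i = 0 \<longleftrightarrow> i \<in> C0)"

definition cocircuit_pos :: "real mat \<Rightarrow> real vec \<Rightarrow> nat set" where
  "cocircuit_pos A c = {i. i < dim_col A \<and> c \<bullet> col A i > 0}"

definition cocircuit_neg :: "real mat \<Rightarrow> real vec \<Rightarrow> nat set" where
  "cocircuit_neg A c = {i. i < dim_col A \<and> - (c \<bullet> col A i) > 0}"

definition simplices :: "real mat \<Rightarrow> nat set set" where
  "simplices A = {S. S \<subseteq> {..<dim_col A} \<and> card S = dim_row A \<and> rank_cols A S = dim_row A}"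

(* Written with a successor rather than with r - 1, so that truncated subtraction
   creates no facets when r = 0. *)
definition facets :: "nat set \<Rightarrow> nat set set" where
  "facets S = {F. F \<subseteq> S \<and> Suc (card F) = card S}"

definition intersect_properly :: "real mat \<Rightarrow> nat set \<Rightarrow> nat set \<Rightarrow> bool" where
  "intersect_properly A S1 S2 \<longleftrightarrow> (\<nexists>Cp Cn. signed_circuit A Cp Cn \<and> Cp \<subseteq> S1 \<and> Cn \<subseteq> S2)"

(* The normal c of a cocircuit is unique up to a non-zero factor, and changing its sign
   swaps the two sides; hence the choice of c is immaterial. *)
definition interior_facet :: "real mat \<Rightarrow> nat set \<Rightarrow> bool" where
  "interior_facet A F \<longleftrightarrow> (\<exists>C0 c. cocircuit A C0 \<and> F \<subseteq> C0 \<and> cocircuit_normal A C0 c \<and>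
     cocircuit_pos A c \<noteq> {} \<and> cocircuit_neg A c \<noteq> {})"

definition interior_facets :: "real mat \<Rightarrow> nat set set" where
  "interior_facets A = {F. (\<exists>S\<in>simplices A. F \<in> facets S) \<and> interior_facet A F}"

definition pairwise_proper :: "real mat \<Rightarrow> nat set set \<Rightarrow> bool" where
  "pairwise_proper A TT \<longleftrightarrow> (\<forall>S\<in>TT. \<forall>S'\<in>TT. S \<noteq> S' \<longrightarrow> intersect_properly A S S')"

definition covering :: "real mat \<Rightarrow> nat set set \<Rightarrow> bool" where
  "covering A TT \<longleftrightarrow> (\<forall>S\<in>TT. \<forall>F\<in>facets S. interior_facet A F \<longrightarrow> (\<exists>S'\<in>TT. S' \<noteq> S \<and> F \<subseteq> S'))"

(* In the following, FS is the set of feasible simplices. *)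

definition partial_triangulation :: "real mat \<Rightarrow> nat set set \<Rightarrow> nat set set \<Rightarrow> bool" where
  "partial_triangulation A FS TT \<longleftrightarrow> TT \<subseteq> FS \<and> pairwise_proper A TT"

definition triangulation :: "real mat \<Rightarrow> nat set set \<Rightarrow> nat set set \<Rightarrow> bool" where
  "triangulation A FS TT \<longleftrightarrow> TT \<noteq> {} \<and> TT \<subseteq> FS \<and> pairwise_proper A TT \<and> covering A TT"

(* Lexicographic order; only meant for finite sets. *)
inductive lex_less :: "nat set \<Rightarrow> nat set \<Rightarrow> bool" where
  empty: "S \<noteq> {} \<Longrightarrow> lex_less {} S"
| min_less: "S \<noteq> {} \<Longrightarrow> R \<noteq> {} \<Longrightarrow> Min S < Min R \<Longrightarrow> lex_less S R"
| min_eq: "S \<noteq> {} \<Longrightarrow> R \<noteq> {} \<Longrightarrow> Min S = Min R \<Longrightarrow>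
    lex_less (S - {Min S}) (R - {Min R}) \<Longrightarrow> lex_less S R"

(* The k-th element (k = 1, 2, ..., card X) of X in increasing lexicographic order. *)
definition lex_nth :: "nat set set \<Rightarrow> nat \<Rightarrow> nat set" where
  "lex_nth X k = (THE S. S \<in> X \<and> Suc (card {R \<in> X. lex_less R S}) = k)"

lemma lex_less_irrefl: "lex_less S R \<Longrightarrow> finite S \<Longrightarrow> S \<noteq> R"
  by (induction rule: lex_less.induct) auto

lemma lex_less_trans:
  "lex_less S R \<Longrightarrow> lex_less R Q \<Longrightarrow> finite S \<Longrightarrow> finite R \<Longrightarrow> finite Q \<Longrightarrow> lex_less S Q"
proof (induction arbitrary: Q rule: lex_less.induct)
  case (empty S)
  from empty.prems(1) have "Q \<noteq> {}" by (cases rule: lex_less.cases) simp_all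
  then show ?case by (rule lex_less.empty)
next
  case (min_less S R)
  from min_less.prems(1) have "Q \<noteq> {}" "Min R \<le> Min Q"
    by (cases rule: lex_less.cases; use min_less.hyps in simp)+
  with min_less.hyps show ?case by (intro lex_less.min_less) linarith+
next
  case (min_eq S R)
  from min_eq.prems(1) show ?case
  proof (cases rule: lex_less.cases)
    case empty
    with min_eq show ?thesis by simp
  next
    case min_less
    with min_eq.hyps show ?thesis by (intro lex_less.min_less) linarith+
  next
    case A: min_eq
    have "lex_less (S - {Min S}) (Q - {Min Q})"
      using min_eq.IH[OF A(4)] min_eq.prems by simp
    with min_eq.hyps(1) A(2) trans[OF min_eq.hyps(3) A(3)] show ?thesis
      by (rule lex_less.min_eq)
  qed
qed

lemma lex_less_total:
  "finite S \<Longrightarrow> finite R \<Longrightarrow> S \<noteq> R \<Longrightarrow> lex_less S R \<or> lex_less R S"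
proof (induction "card S" arbitrary: S R rule: less_induct)
  case less
  show ?case
  proof (cases "S = {} \<or> R = {}")
    case True
    with less.prems show ?thesis by (auto intro: lex_less.empty)
  next
    case ne: False
    show ?thesis
    proof (cases "Min S = Min R")
      case eq: True
      have mem: "Min S \<in> S" "Min R \<in> R" using ne less.prems by auto
      have "S - {Min S} \<noteq> R - {Min R}"
        using mem eq less.prems(3) by (metis insert_Diff)
      moreover have "card (S - {Min S}) < card S"
        using mem less.prems(1) by (meson card_Diff1_less)
      ultimately have "lex_less (S - {Min S}) (R - {Min R}) \<or> lex_less (R - {Min R}) (S - {Min S})"
        using less.hyps[OF _ finite_Diff[OF less.prems(1)] finite_Diff[OF less.prems(2)]] by blast
      then show ?thesis
        using lex_less.min_eq[of S R] lex_less.min_eq[of R S] ne eq eq[symmetric] by blast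
    next
      case False
      then have "Min S < Min R \<or> Min R < Min S" by linarith
      then show ?thesis using lex_less.min_less[of S R] lex_less.min_less[of R S] ne by blast
    qed
  qed
qed

lemma lex_rank_mono:
  assumes "finite X" "\<forall>S\<in>X. finite S" "S \<in> X" "R \<in> X" "lex_less S R"
  shows "card {Q \<in> X. lex_less Q S} < card {Q \<in> X. lex_less Q R}"
proof (rule psubset_card_mono)
  show "finite {Q \<in> X. lex_less Q R}" using assms by simp
  have "{Q \<in> X. lex_less Q S} \<subseteq> {Q \<in> X. lex_less Q R}"
    using assms lex_less_trans by blast
  moreover have "S \<in> {Q \<in> X. lex_less Q R}" "S \<notin> {Q \<in> X. lex_less Q S}"
    using assms lex_less_irrefl by auto
  ultimately show "{Q \<in> X. lex_less Q S} \<subset> {Q \<in> X. lex_less Q R}" by blast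
qed

lemma lex_rank_bij:
  assumes "finite X" "\<forall>S\<in>X. finite S"
  shows "bij_betw (\<lambda>S. Suc (card {R \<in> X. lex_less R S})) X {1..card X}"
proof -
  let ?g = "\<lambda>S. Suc (card {R \<in> X. lex_less R S})"
  have inj: "inj_on ?g X"
  proof (rule inj_onI, rule ccontr)
    fix S R assume "S \<in> X" "R \<in> X" "?g S = ?g R" "S \<noteq> R"
    then show False
      using lex_less_total[of S R] lex_rank_mono[OF assms, of S R] lex_rank_mono[OF assms, of R S]
        assms(2) by auto
  qed
  have "?g ` X \<subseteq> {1..card X}"
  proof
    fix k assume "k \<in> ?g ` X"
    then obtain S where S: "S \<in> X" "k = ?g S" by auto
    have "{R \<in> X. lex_less R S} \<subset> X" using S assms lex_less_irrefl by blast
    from psubset_card_mono[OF assms(1) this] show "k \<in> {1..card X}" using S by simp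
  qed
  then have "?g ` X = {1..card X}"
    by (rule card_subset_eq[rotated]) (simp_all add: card_image[OF inj])
  with inj show ?thesis by (simp add: bij_betw_def)
qed

lemma lex_nth_rank:
  assumes "finite X" "\<forall>S\<in>X. finite S" "S \<in> X"
  shows "lex_nth X (Suc (card {R \<in> X. lex_less R S})) = S"
  unfolding lex_nth_def
  using lex_rank_bij[OF assms(1,2)] assms(3) by (intro the_equality) (auto simp: bij_betw_def inj_on_def)

lemma lex_nth_bij:
  assumes "finite X" "\<forall>S\<in>X. finite S"
  shows "bij_betw (lex_nth X) {1..card X} X"
proof -
  let ?g = "\<lambda>S. Suc (card {R \<in> X. lex_less R S})"
  have g: "?g ` X = {1..card X}" using lex_rank_bij[OF assms] by (simp add: bij_betw_def)
  have ng: "lex_nth X (?g S) = S" if "S \<in> X" for S using lex_nth_rank[OF assms that] .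
  have "?g (lex_nth X k) = k \<and> lex_nth X k \<in> X" if "k \<in> {1..card X}" for k
  proof -
    from that g have "k \<in> ?g ` X" by simp
    then obtain S where "S \<in> X" "k = ?g S" by blast
    then show ?thesis using ng by simp
  qed
  then show ?thesis
    by (intro bij_betw_byWitness[where f' = ?g]) (use g ng in blast)+
qed

lemma lex_nth_mono:
  assumes "finite X" "\<forall>S\<in>X. finite S" "1 \<le> i" "i < j" "j \<le> card X"
  shows "lex_less (lex_nth X i) (lex_nth X j)"
proof -
  let ?g = "\<lambda>S. Suc (card {R \<in> X. lex_less R S})"
  have "i \<in> ?g ` X" "j \<in> ?g ` X"
    using lex_rank_bij[OF assms(1,2)] assms(3-5) by (auto simp: bij_betw_def)
  then obtain S R where SR: "S \<in> X" "i = ?g S" "R \<in> X" "j = ?g R" by auto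
  have "lex_less S R"
    using lex_less_total[of S R] lex_rank_mono[OF assms(1,2), of R S] SR assms(2,4) by fastforce
  then show ?thesis using SR lex_nth_rank[OF assms(1,2)] by simp
qed

lemma finite_simplices: "finite (simplices A)" "S \<in> simplices A \<Longrightarrow> finite S"
  by (auto simp: simplices_def intro: finite_subset)

definition intfacets :: "real mat \<Rightarrow> nat set set \<Rightarrow> nat \<Rightarrow> nat set" where
  "intfacets A FS s =
     {f \<in> {1..card (interior_facets A)}. lex_nth (interior_facets A) f \<in> facets (lex_nth FS s)}"

definition adm :: "real mat \<Rightarrow> nat set set \<Rightarrow> nat set \<Rightarrow> nat set" where
  "adm A FS T = {s \<in> {1..card FS}.
     \<forall>s'\<in>T. s > s' \<and> intersect_properly A (lex_nth FS s) (lex_nth FS s')}"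

definition free :: "real mat \<Rightarrow> nat set set \<Rightarrow> nat set \<Rightarrow> nat set" where
  "free A FS T = {f \<in> {1..card (interior_facets A)}. \<exists>!s. s \<in> T \<and> f \<in> intfacets A FS s}"

definition right_extendable :: "real mat \<Rightarrow> nat set set \<Rightarrow> nat set \<Rightarrow> bool" where
  "right_extendable A FS T \<longleftrightarrow> (\<exists>T'. T \<subseteq> T' \<and> T' \<subseteq> {1..card FS} \<and>
     triangulation A FS (lex_nth FS ` T') \<and> (\<forall>t'\<in>T' - T. \<forall>t\<in>T. t < t'))"

end

theory Submission
  imports Defs
begin

text \<open>Let T' be a triangulation extending T to the right; the covering set is the difference
  T' - T. Its members exceed all of T and meet each other and the simplices of T properly, because
  T' is pairwise proper, so they are admissible. A free facet F lies in a single simplex of T. Since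
  F is interior, the covering property of T' supplies a second simplex containing F, and by
  uniqueness it lies outside T. That F is again a facet there is
  \<open>facets_simplex_if_subset\<close>.\<close>

lemma interior_facets_finite:
  "finite (interior_facets A)" "F \<in> interior_facets A \<Longrightarrow> finite F"
proof -
  have "interior_facets A \<subseteq> Pow {..<dim_col A}"
    by (auto simp: interior_facets_def simplices_def facets_def)
  then show "finite (interior_facets A)" "F \<in> interior_facets A \<Longrightarrow> finite F"
    by (auto intro: finite_subset)
qed

lemma lex_nth_interior_facets:
  assumes "f \<in> {1..card (interior_facets A)}"
  shows "lex_nth (interior_facets A) f \<in> interior_facets A"
proof -
  have "bij_betw (lex_nth (interior_facets A)) {1..card (interior_facets A)} (interior_facets A)"
    by (rule lex_nth_bij) (auto intro: interior_facets_finite)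
  then show ?thesis
    using assms by (rule bij_betw_apply)
qed

text \<open>All simplices have the same cardinality \<open>dim_row A\<close>, so being a facet is
  only a matter of inclusion. This links \<open>covering\<close>, which yields
  \<open>F \<subseteq> S'\<close>, with \<open>intfacets\<close>, which asks for
  \<open>F \<in> facets S'\<close>.\<close>

lemma facets_simplex_if_subset:
  assumes "S \<in> simplices A" "S' \<in> simplices A" "F \<in> facets S" "F \<subseteq> S'"
  shows "F \<in> facets S'"
  using assms by (simp add: simplices_def facets_def)

theorem theorem11:
  fixes A :: "real mat" and r n :: nat and FS :: "nat set set" and T :: "nat set"
  assumes "A \<in> carrier_mat r n"
    and "vec_space.rank r A = r"
    and "FS \<subseteq> simplices A"
    and "T \<subseteq> {1..card FS}"
    and "T \<noteq> {}"
    and "partial_triangulation A FS (lex_nth FS ` T)"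
    and "right_extendable A FS T"
  shows "\<exists>C \<subseteq> adm A FS T.
    (\<forall>s\<in>C. \<forall>s'\<in>C - {s}. intersect_properly A (lex_nth FS s) (lex_nth FS s')) \<and>
    (\<forall>f\<in>free A FS T. \<exists>s\<in>C. f \<in> intfacets A FS s)"
proof -
  have finFS: "finite FS" "\<forall>S\<in>FS. finite S"
    using assms(3) finite_simplices finite_subset by blast+
  have inj: "inj_on (lex_nth FS) {1..card FS}"
    using lex_nth_bij[OF finFS] by (simp add: bij_betw_def)
  obtain T' where T': "T \<subseteq> T'" "T' \<subseteq> {1..card FS}" "\<forall>t'\<in>T' - T. \<forall>t\<in>T. t < t'"
    and tri: "triangulation A FS (lex_nth FS ` T')"
    using assms(7) by (auto simp: right_extendable_def)
  have proper: "intersect_properly A (lex_nth FS s) (lex_nth FS s')"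
    if "s \<in> T'" "s' \<in> T'" "s \<noteq> s'" for s s'
  proof -
    \<comment> \<open>\<open>pairwise_proper\<close> compares distinct simplices, so distinct
      numbers must first be turned into distinct sets by injectivity of the numbering.\<close>
    have "lex_nth FS s \<noteq> lex_nth FS s'"
      using inj T'(2) that by (meson inj_onD subsetD)
    then show ?thesis
      using tri that by (simp add: triangulation_def pairwise_proper_def)
  qed
  have simplex: "lex_nth FS s \<in> simplices A" if "s \<in> T'" for s
    using tri that assms(3) by (auto simp: triangulation_def)
  have "\<exists>s\<in>T' - T. f \<in> intfacets A FS s" if f: "f \<in> free A FS T" for f
  proof -
    let ?F = "lex_nth (interior_facets A) f"
    obtain s where s: "s \<in> T" "f \<in> intfacets A FS s"
      and unique: "\<And>t. t \<in> T \<Longrightarrow> f \<in> intfacets A FS t \<Longrightarrow> t = s"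
      using f unfolding free_def by blast
    have fM: "f \<in> {1..card (interior_facets A)}" and F: "?F \<in> facets (lex_nth FS s)"
      using s(2) by (simp_all add: intfacets_def)
    have "interior_facet A ?F"
      using lex_nth_interior_facets[OF fM] by (simp add: interior_facets_def)
    moreover have "s \<in> T'"
      using s(1) T'(1) by blast
    ultimately obtain s' where s': "s' \<in> T'" "lex_nth FS s' \<noteq> lex_nth FS s" "?F \<subseteq> lex_nth FS s'"
      using tri F unfolding triangulation_def covering_def by blast
    have "f \<in> intfacets A FS s'"
      using facets_simplex_if_subset[OF simplex[OF \<open>s \<in> T'\<close>] simplex[OF s'(1)] F s'(3)] fM
      by (simp add: intfacets_def)
    \<comment> \<open>If \<open>s'\<close> were in \<open>T\<close>, freeness of \<open>f\<close>
      would force \<open>s' = s\<close>, although the two simplices differ.\<close>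
    then show ?thesis
      using unique s'(1,2) by blast
  qed
  moreover have "T' - T \<subseteq> adm A FS T"
  proof
    fix s
    assume s: "s \<in> T' - T"
    \<comment> \<open>Right-extension gives the order; \<open>s\<close> and \<open>s'\<close> differ
      because only \<open>s'\<close> is in \<open>T\<close>, so \<open>proper\<close>
      applies.\<close>
    have "s' < s \<and> intersect_properly A (lex_nth FS s) (lex_nth FS s')" if "s' \<in> T" for s'
      using s that T'(1,3) proper[of s s'] by blast
    then show "s \<in> adm A FS T"
      using s T'(2) by (auto simp: adm_def)
  qed
  ultimately show ?thesis
    using proper by (intro exI[of _ "T' - T"]) blast
qed

end
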